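(* Let $X$ be a normed space, let $F\subset X$ be a closed, bounded, convex set containing the origin as an interior point, and let $\Omega,\Omega_1,\ldots,\Omega_n$ ($n\ge 1$) be nonempty closed subsets of $X$. Suppose that one of the following holds: (i) $X$ is finite dimensional; (ii) $X$ is a reflexive Banach space and $\Omega$ and $\Omega_i$, $i=1,\ldots,n$, are nonempty weakly closed subsets of $X$. Let $\bar x\in\Omega$ and $r\ge 0$. Then $\bar x$ is a solution of the optimization problem $$\text{minimize } T(x)=\max\{T_F(x;\Omega_i): i=1,\ldots,n\}\quad\text{subject to } x\in\Omega$$ with $r=T(\bar x)$ if and only if $\bar x$ is a solution of the smallest intersecting ball problem with smallest radius $r$.
   Context: For a nonempty set $Q\subset X$ and $x\in X$, the minimal time function is $T_F(x;Q)=\inf\{t\ge 0: (x+tF)\cap Q\ne\emptyset\}$. A solution of the optimization problem is a point $\bar x\in\Omega$ with $T(\bar x)\le T(x)$ for all $x\in\Omega$. A point $\bar x\in\Omega$ is a solution of the smallest intersecting ball problem with smallest radius $r\ge 0$ if $(\bar x+rF)\cap\Omega_i\ne\emptyset$ for all $i=1,\ldots,n$, and for any $x\in\Omega$ and $t\ge 0$ with $(x+tF)\cap\Omega_i\ne\emptyset$ for all $i=1,\ldots,n$, one has $r\le t$. *)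

theory Defs
  imports "HOL-Analysis.Analysis"
begin

definition finite_dimensional_space :: "'a::real_vector itself \<Rightarrow> bool" where
  "finite_dimensional_space _ \<longleftrightarrow> (\<exists>B::'a set. finite B \<and> span B = UNIV)"

definition reflexive_banach_space :: "'a::real_normed_vector itself \<Rightarrow> bool" where
  "reflexive_banach_space _ \<longleftrightarrow>
     complete (UNIV :: 'a set) \<and>
     (\<forall>\<Phi> :: ('a \<Rightarrow>\<^sub>L real) \<Rightarrow>\<^sub>L real. \<exists>x. \<forall>f. blinfun_apply \<Phi> f = blinfun_apply f x)"

definition weak_topology :: "'a::real_normed_vector topology" where
  "weak_topology =
     topology_generated_by {blinfun_apply f -` U | (f :: 'a \<Rightarrow>\<^sub>L real) U. open U}"

text \<open>The infimum is taken in \<^typ>\<open>real\<close>, where \<^term>\<open>Inf {}\<close> is unspecified. The set is nonempty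
  whenever \<^term>\<open>Q\<close> is nonempty and \<^term>\<open>0\<close> is an interior point of \<^term>\<open>F\<close>.\<close>

definition minimal_time :: "'a::real_normed_vector set \<Rightarrow> 'a \<Rightarrow> 'a set \<Rightarrow> real" where
  "minimal_time F x Q = Inf {t. 0 \<le> t \<and> (\<lambda>y. x + t *\<^sub>R y) ` F \<inter> Q \<noteq> {}}"

definition max_time ::
  "'a::real_normed_vector set \<Rightarrow> nat \<Rightarrow> (nat \<Rightarrow> 'a set) \<Rightarrow> 'a \<Rightarrow> real" where
  "max_time F n \<Omega>s x = (MAX i\<in>{1..n}. minimal_time F x (\<Omega>s i))"

definition constrained_minimizer :: "('a \<Rightarrow> real) \<Rightarrow> 'a set \<Rightarrow> 'a \<Rightarrow> bool" where
  "constrained_minimizer T \<Omega> x \<longleftrightarrow> x \<in> \<Omega> \<and> (\<forall>y\<in>\<Omega>. T x \<le> T y)"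

definition smallest_intersecting_ball ::
  "'a::real_normed_vector set \<Rightarrow> nat \<Rightarrow> (nat \<Rightarrow> 'a set) \<Rightarrow> 'a set \<Rightarrow> 'a \<Rightarrow> real \<Rightarrow> bool" where
  "smallest_intersecting_ball F n \<Omega>s \<Omega> x r \<longleftrightarrow>
     x \<in> \<Omega> \<and> 0 \<le> r \<and>
     (\<forall>i\<in>{1..n}. (\<lambda>y. x + r *\<^sub>R y) ` F \<inter> \<Omega>s i \<noteq> {}) \<and>
     (\<forall>x'\<in>\<Omega>. \<forall>t\<ge>0. (\<forall>i\<in>{1..n}. (\<lambda>y. x' + t *\<^sub>R y) ` F \<inter> \<Omega>s i \<noteq> {}) \<longrightarrow> r \<le> t)"

end

theory Submission
  imports Defs
begin

text \<open>The infimum defining the minimal time is attained: points of \<open>x + t\<^sub>k F\<close> in \<open>Q\<close>, with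
  \<open>t\<^sub>k\<close> decreasing to the infimum \<open>t\<close>, form a bounded sequence, and a cluster point (weak in the
  reflexive case) lies in \<open>Q\<close> and in every \<open>x + t\<^sub>k F\<close>, hence in \<open>x + t F\<close>. So the minimal time
  is at most \<open>t\<close> iff \<open>x + t F\<close> meets \<open>Q\<close>, and both sides of the equivalence express the same order
  relations. The weak closedness of \<open>x + t\<^sub>k F\<close> is Mazur's theorem, a consequence of
  Hahn-Banach, and weak cluster points come from Tychonoff's theorem.\<close>

section \<open>Sublinear functionals and the Hahn-Banach theorem\<close>

definition sublinear :: "('a::real_vector \<Rightarrow> real) \<Rightarrow> bool" where
  "sublinear q \<longleftrightarrow> (\<forall>x y. q (x + y) \<le> q x + q y) \<and> (\<forall>c>0. \<forall>x. q (c *\<^sub>R x) = c * q x)"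

lemma sublinear_add: "sublinear q \<Longrightarrow> q (x + y) \<le> q x + q y"
  and sublinear_scale: "sublinear q \<Longrightarrow> c > 0 \<Longrightarrow> q (c *\<^sub>R x) = c * q x"
  by (auto simp: sublinear_def)

lemma sublinear_0: "sublinear q \<Longrightarrow> q 0 = 0"
  using sublinear_scale[of q 2 0] by simp

lemma sublinear_minus: "sublinear q \<Longrightarrow> - q (- x) \<le> q x"
  using sublinear_add[of q x "- x"] sublinear_0[of q] by simp

text \<open>Common core of three constructions: flattening, the infimum of a chain, and the
  Minkowski functional. Taking infima over \<open>a\<close> and \<open>b\<close> in turn in
  \<open>add\<close> gives subadditivity; \<open>scale\<close> gives one half of homogeneity, and
  its use with the inverse scalar the other half.\<close>

lemma sublinear_Inf:
  fixes A :: "'a::real_vector \<Rightarrow> real set"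
  assumes ne: "\<And>x. A x \<noteq> {}" and bdd: "\<And>x. bdd_below (A x)"
    and add: "\<And>x y a b. a \<in> A x \<Longrightarrow> b \<in> A y \<Longrightarrow> \<exists>c\<in>A (x + y). c \<le> a + b"
    and scale: "\<And>c x a. c > 0 \<Longrightarrow> a \<in> A x \<Longrightarrow> c * a \<in> A (c *\<^sub>R x)"
  shows "sublinear (\<lambda>x. Inf (A x))"
  unfolding sublinear_def
proof (intro conjI allI impI)
  fix x y
  have "Inf (A (x + y)) \<le> a + b" if "a \<in> A x" "b \<in> A y" for a b
    using add[OF that] cInf_lower[OF _ bdd] by (meson order_trans)
  then have "Inf (A (x + y)) - a \<le> Inf (A y)" if "a \<in> A x" for a
    using that by (intro cInf_greatest[OF ne]) (metis add.commute diff_le_eq)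
  then have "Inf (A (x + y)) - Inf (A y) \<le> Inf (A x)"
    by (intro cInf_greatest[OF ne]) (simp add: algebra_simps)
  then show "Inf (A (x + y)) \<le> Inf (A x) + Inf (A y)"
    by simp
next
  have le: "Inf (A (c *\<^sub>R x)) \<le> c * Inf (A x)" if "c > 0" for c x
  proof -
    have "Inf (A (c *\<^sub>R x)) / c \<le> Inf (A x)"
      using that by (intro cInf_greatest[OF ne])
        (simp add: cInf_lower[OF scale bdd] pos_divide_le_eq mult.commute[of _ c])
    with that show ?thesis
      by (simp add: field_simps)
  qed
  fix c :: real and x
  assume c: "c > 0"
  have "Inf (A x) \<le> inverse c * Inf (A (c *\<^sub>R x))"
    using le[of "inverse c" "c *\<^sub>R x"] c by simp
  with c have "c * Inf (A x) \<le> Inf (A (c *\<^sub>R x))"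
    by (simp add: field_simps)
  with le[OF c, of x] show "Inf (A (c *\<^sub>R x)) = c * Inf (A x)"
    by simp
qed

text \<open>For sublinear \<open>q\<close>, the largest sublinear functional below \<open>q\<close> whose value at \<open>- y\<close> is at
  most \<open>- q y\<close>.\<close>

definition flatten :: "('a::real_vector \<Rightarrow> real) \<Rightarrow> 'a \<Rightarrow> 'a \<Rightarrow> real" where
  "flatten q y x = Inf {q (x + t *\<^sub>R y) - t * q y | t. t \<ge> 0}"

text \<open>The parameter \<open>t = 0\<close> gives the bound by \<open>q\<close>, and
  \<open>t = 1\<close> the bound at \<open>- y\<close>. Subadditivity of \<open>q\<close> keeps the
  infimum finite, with lower bound \<open>- q (- x)\<close>. Parameters add and scale along with the
  points, so \<open>sublinear_Inf\<close> applies.\<close>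

lemma
  assumes q: "sublinear q"
  shows sublinear_flatten: "sublinear (flatten q y)"
    and flatten_le: "flatten q y x \<le> q x"
    and flatten_minus: "flatten q y (- y) \<le> - q y"
proof -
  define A where "A x = {q (x + t *\<^sub>R y) - t * q y | t. t \<ge> 0}" for x
  have mem: "q (x + t *\<^sub>R y) - t * q y \<in> A x" if "t \<ge> 0" for x t
    using that by (auto simp: A_def)
  have bdd: "bdd_below (A x)" for x
  proof (rule bdd_belowI)
    fix a assume "a \<in> A x"
    then obtain t where t: "t \<ge> 0" and a: "a = q (x + t *\<^sub>R y) - t * q y"
      by (auto simp: A_def)
    have "t * q y = q (t *\<^sub>R y)"
      using t q by (cases "t = 0") (auto simp: sublinear_0 sublinear_scale)
    also have "\<dots> \<le> q (x + t *\<^sub>R y) + q (- x)"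
      using sublinear_add[OF q, of "x + t *\<^sub>R y" "- x"] by simp
    finally show "- q (- x) \<le> a"
      using a by simp
  qed
  have le: "flatten q y x \<le> q (x + t *\<^sub>R y) - t * q y" if "t \<ge> 0" for x t
    using cInf_lower[OF mem[OF that] bdd] by (simp add: flatten_def A_def)
  show "flatten q y x \<le> q x"
    using le[of 0 x] by simp
  show "flatten q y (- y) \<le> - q y"
    using le[of 1 "- y"] sublinear_0[OF q] by simp
  have "sublinear (\<lambda>x. Inf (A x))"
  proof (rule sublinear_Inf[OF _ bdd])
    show "A x \<noteq> {}" for x
      using mem[of 0 x] by auto
    show "\<exists>c\<in>A (u + v). c \<le> a + b" if a: "a \<in> A u" and b: "b \<in> A v" for u v a b
    proof -
      obtain s where s: "s \<ge> 0" "a = q (u + s *\<^sub>R y) - s * q y"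
        using a by (auto simp: A_def)
      obtain t where t: "t \<ge> 0" "b = q (v + t *\<^sub>R y) - t * q y"
        using b by (auto simp: A_def)
      have "q (u + v + (s + t) *\<^sub>R y) - (s + t) * q y \<le> a + b"
        using sublinear_add[OF q, of "u + s *\<^sub>R y" "v + t *\<^sub>R y"] s t
        by (simp add: algebra_simps)
      with mem[of "s + t" "u + v"] s t show ?thesis
        by auto
    qed
    show "c * a \<in> A (c *\<^sub>R u)" if "c > 0" and a: "a \<in> A u" for c u a
    proof -
      obtain s where s: "s \<ge> 0" "a = q (u + s *\<^sub>R y) - s * q y"
        using a by (auto simp: A_def)
      have "c * a = q (c *\<^sub>R u + (c * s) *\<^sub>R y) - (c * s) * q y"
        using sublinear_scale[OF q \<open>c > 0\<close>, of "u + s *\<^sub>R y"] s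
        by (simp add: scaleR_add_right right_diff_distrib)
      with mem[of "c * s" "c *\<^sub>R u"] s \<open>c > 0\<close> show ?thesis
        by simp
    qed
  qed
  then show "sublinear (flatten q y)"
    by (simp add: flatten_def[abs_def] A_def)
qed

text \<open>A minimal sublinear functional equals all its flattenings, which makes it odd, hence linear.\<close>

lemma sublinear_dominates_linear:
  assumes p: "sublinear p"
  obtains f where "linear f" and "\<And>x. f x \<le> p x"
proof -
  define S where "S = {q. sublinear q \<and> q \<le> p}"
  \<comment> \<open>The order is reversed, so the maximal element from Zorn's lemma is a minimal
    functional.\<close>
  have po: "partial_order_on S (relation_of (\<lambda>a b. b \<le> a) S)"
    by (rule partial_order_on_relation_ofI) auto
  have "\<exists>m\<in>S. \<forall>a\<in>S. a \<le> m \<longrightarrow> a = m"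
  proof (rule predicate_Zorn[OF po])
    fix C
    assume C: "C \<in> Chains (relation_of (\<lambda>a b. b \<le> a) S)"
    show "\<exists>u\<in>S. \<forall>a\<in>C. u \<le> a"
    proof (cases "C = {}")
      case True
      then show ?thesis
        using p by (auto simp: S_def)
    next
      case False
      have CS: "sublinear a" "a x \<le> p x" if "a \<in> C" for a x
        using Chains_relation_of[OF C] that by (auto simp: S_def le_fun_def)
      have total: "a \<le> b \<or> b \<le> a" if "a \<in> C" "b \<in> C" for a b
        using C that by (auto simp: Chains_def relation_of_def)
      define A where "A x = (\<lambda>a. a x) ` C" for x
      have bdd: "bdd_below (A x)" for x
      proof (rule bdd_belowI)
        fix r assume "r \<in> A x"
        then obtain a where a: "a \<in> C" "r = a x"
          by (auto simp: A_def)
        show "- p (- x) \<le> r"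
          using sublinear_minus[OF CS(1)[OF a(1)], of x] CS(2)[OF a(1), of "- x"] a by linarith
      qed
      have "sublinear (\<lambda>x. Inf (A x))"
      proof (rule sublinear_Inf[OF _ bdd])
        show "A x \<noteq> {}" for x
          using False by (auto simp: A_def)
        show "\<exists>c\<in>A (x + y). c \<le> a + b" if ab: "a \<in> A x" "b \<in> A y" for x y a b
        proof -
          obtain g h where g: "g \<in> C" "a = g x" and h: "h \<in> C" "b = h y"
            using ab by (auto simp: A_def)
          \<comment> \<open>Of two members of a chain, the smaller one serves both points.\<close>
          then obtain k where k: "k \<in> C" "k x \<le> a" "k y \<le> b"
            using total[of g h] by (auto simp: le_fun_def)
          then have "k (x + y) \<le> a + b"
            using sublinear_add[OF CS(1)[OF k(1)], of x y] by linarith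
          with k show ?thesis
            by (auto simp: A_def)
        qed
        show "c * a \<in> A (c *\<^sub>R x)" if c: "c > 0" and a: "a \<in> A x" for c x a
        proof -
          obtain g where "g \<in> C" "a = g x"
            using a by (auto simp: A_def)
          then show ?thesis
            unfolding A_def using sublinear_scale[OF CS(1) c, of g x] by (intro image_eqI[of _ _ g]) auto
        qed
      qed
      moreover have lower: "Inf (A x) \<le> a x" if "a \<in> C" for a x
        using that by (intro cInf_lower[OF _ bdd]) (auto simp: A_def)
      moreover obtain a where "a \<in> C"
        using False by auto
      then have "Inf (A x) \<le> p x" for x
        using lower[of a x] CS(2)[of a x] by linarith
      ultimately show ?thesis
        by (intro bexI[of _ "\<lambda>x. Inf (A x)"]) (auto simp: S_def le_fun_def)
    qed
  qed
  then obtain m where m: "sublinear m" "m \<le> p"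
    and minimal: "\<And>a. sublinear a \<Longrightarrow> a \<le> p \<Longrightarrow> a \<le> m \<Longrightarrow> a = m"
    by (auto simp: S_def)
  \<comment> \<open>The flattening lies below \<open>m\<close>, hence below \<open>p\<close>, and
    minimality of \<open>m\<close> forces equality.\<close>
  have "flatten m y = m" for y
    using flatten_le[OF m(1)] m
    by (intro minimal sublinear_flatten) (auto simp: le_fun_def intro: order_trans)
  \<comment> \<open>Now \<open>flatten_minus\<close> bounds \<open>m (- y)\<close> from above by
    \<open>- m y\<close>; \<open>sublinear_minus\<close> is the opposite inequality.\<close>
  then have minus: "m (- y) = - m y" for y
    using flatten_minus[OF m(1), of y] sublinear_minus[OF m(1), of y] by simp
  have "linear m"
  proof (rule linearI)
    \<comment> \<open>By oddness, subadditivity at \<open>- x\<close> and \<open>- y\<close> is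
      superadditivity at \<open>x\<close> and \<open>y\<close>.\<close>
    show "m (x + y) = m x + m y" for x y
      using sublinear_add[OF m(1), of x y] sublinear_add[OF m(1), of "- x" "- y"]
        minus[of "x + y"] minus[of x] minus[of y] by simp
    show "m (c *\<^sub>R x) = c *\<^sub>R m x" for c x
    proof (cases c "0::real" rule: linorder_cases)
      case less
      then have "m (- ((- c) *\<^sub>R x)) = - (- c * m x)"
        using minus[of "- c *\<^sub>R x"] sublinear_scale[OF m(1), of "- c" x] by simp
      then show ?thesis
        by simp
    qed (auto simp: m sublinear_0 sublinear_scale)
  qed
  then show ?thesis
    using m by (intro that) (auto simp: le_fun_def)
qed

text \<open>Dominating the flattening at \<open>z\<close> instead of \<open>p\<close> itself forces
  \<open>f (- z) \<le> - p z\<close>, which by linearity is \<open>p z \<le> f z\<close>.\<close>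

lemma Hahn_Banach_sublinear:
  assumes p: "sublinear p"
  obtains f where "linear f" and "\<And>x. f x \<le> p x" and "f z = p z"
proof -
  obtain f where f: "linear f" and le: "\<And>x. f x \<le> flatten p z x"
    using sublinear_dominates_linear[OF sublinear_flatten[OF p]] by blast
  have fp: "f x \<le> p x" for x
    using le[of x] flatten_le[OF p, of z x] by linarith
  moreover have "f z = p z"
    using le[of "- z"] flatten_minus[OF p, of z] linear_neg[OF f, of z] fp[of z] by linarith
  ultimately show ?thesis
    using f that by blast
qed

section \<open>Separation of a point from an open convex set\<close>

text \<open>A linear \<open>f\<close> below the Minkowski functional of \<open>C\<close> that agrees
  with it at \<open>z\<close> separates: the functional is at most 1 on \<open>C\<close> and at
  least 1 at \<open>z\<close>. A ball around 0 inside \<open>C\<close> makes \<open>f\<close>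
  bounded.\<close>

lemma separate_point_open_convex:
  fixes C :: "'a::real_normed_vector set"
  assumes "open C" and C: "convex C" and "0 \<in> C" and z: "z \<notin> C"
  obtains f :: "'a \<Rightarrow> real" where "bounded_linear f" and "\<And>x. x \<in> C \<Longrightarrow> f x \<le> 1" and "1 \<le> f z"
proof -
  obtain d where d: "d > 0" "ball 0 d \<subseteq> C"
    using assms open_contains_ball by blast
  text \<open>\<open>Inf (A x)\<close> is the Minkowski functional of \<open>C\<close>.\<close>
  define A where "A x = {t::real. t > 0 \<and> x /\<^sub>R t \<in> C}" for x
  have mem: "t \<in> A x" if "t > norm x / d" for t x
  proof -
    from that d have "t > 0"
      by (metis divide_nonneg_pos le_less_trans norm_ge_zero)
    moreover from this that d have "norm (x /\<^sub>R t) < d"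
      by (simp add: field_simps)
    ultimately show ?thesis
      using d by (auto simp: A_def)
  qed
  have bdd: "bdd_below (A x)" for x
    by (rule bdd_belowI[of _ 0]) (auto simp: A_def)
  have p: "sublinear (\<lambda>x. Inf (A x))"
  proof (rule sublinear_Inf[OF _ bdd])
    show "A x \<noteq> {}" for x
      using mem[of x "norm x / d + 1"] by auto
    show "\<exists>c\<in>A (x + y). c \<le> a + b" if "a \<in> A x" "b \<in> A y" for x y a b
    proof (rule bexI[of _ "a + b"])
      have ab: "a > 0" "b > 0" "x /\<^sub>R a \<in> C" "y /\<^sub>R b \<in> C"
        using that by (auto simp: A_def)
      \<comment> \<open>The point \<open>(x + y) /\<^sub>R (a + b)\<close> is written as a convex
        combination of \<open>x /\<^sub>R a\<close> and \<open>y /\<^sub>R b\<close>.\<close>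
      then have "(a / (a + b)) *\<^sub>R (x /\<^sub>R a) + (b / (a + b)) *\<^sub>R (y /\<^sub>R b) \<in> C"
        by (intro convexD[OF C]) (auto simp: add_divide_distrib[symmetric])
      then have "(x + y) /\<^sub>R (a + b) \<in> C"
        using ab by (simp add: scaleR_add_right inverse_eq_divide)
      then show "a + b \<in> A (x + y)"
        using ab by (simp add: A_def)
    qed simp
    show "c * a \<in> A (c *\<^sub>R x)" if "c > 0" "a \<in> A x" for c x a
      using that by (auto simp: A_def field_simps)
  qed
  obtain f where f: "linear f" and le: "\<And>x. f x \<le> Inf (A x)" and fz: "f z = Inf (A z)"
    using Hahn_Banach_sublinear[OF p, of z] by blast
  \<comment> \<open>Only \<open>t\<close> strictly above \<open>norm x / d\<close> is known to lie
    in \<open>A x\<close>, so the bound is reached by \<open>dense_ge\<close>.\<close>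
  have bound: "f x \<le> norm x / d" for x
  proof (rule order_trans[OF le dense_ge])
    show "Inf (A x) \<le> t" if "t > norm x / d" for t
      using mem[OF that] bdd by (rule cInf_lower)
  qed
  show ?thesis
  proof
    interpret f: linear f by (rule f)
    show "bounded_linear f"
      unfolding bounded_linear_def bounded_linear_axioms_def
    proof (intro conjI f exI[of _ "1 / d"] allI)
      show "norm (f x) \<le> norm x * (1 / d)" for x
        using bound[of x] bound[of "- x"] by (simp add: f.neg)
    qed
    show "f x \<le> 1" if "x \<in> C" for x
      using cInf_lower[OF _ bdd, of 1 x] le[of x] that by (simp add: A_def)
    have "1 \<le> t" if "t \<in> A z" for t
    proof (rule ccontr)
      assume "\<not> 1 \<le> t"
      moreover have "t > 0" "z /\<^sub>R t \<in> C"
        using that by (auto simp: A_def)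
      \<comment> \<open>For \<open>t < 1\<close> the point \<open>z\<close> lies on the segment from
        0 to \<open>z /\<^sub>R t\<close>, whose ends are in \<open>C\<close>.\<close>
      ultimately have "t *\<^sub>R (z /\<^sub>R t) + (1 - t) *\<^sub>R 0 \<in> C"
        using \<open>0 \<in> C\<close> by (intro convexD[OF C]) auto
      with z \<open>t > 0\<close> show False
        by simp
    qed
    then show "1 \<le> f z"
      unfolding fz using mem[of z "norm z / d + 1"] by (intro cInf_greatest) auto
  qed
qed

section \<open>The weak topology and Mazur's theorem\<close>

lemma topspace_weak_topology [simp]:
  "topspace (weak_topology :: 'a::real_normed_vector topology) = UNIV"
proof -
  have "UNIV \<in> {blinfun_apply f -` U | (f :: 'a \<Rightarrow>\<^sub>L real) U. open U}"
    using open_UNIV vimage_UNIV by blast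
  then show ?thesis
    unfolding weak_topology_def topology_generated_by_topspace by blast
qed

lemma openin_weak_topology_vimage:
  fixes f :: "'a::real_normed_vector \<Rightarrow>\<^sub>L real"
  assumes "open U"
  shows "openin weak_topology (blinfun_apply f -` U)"
  unfolding weak_topology_def by (rule topology_generated_by_Basis) (use assms in blast)

text \<open>Separating the thickening of \<open>S\<close> by a small ball, rather than \<open>S\<close>, makes the separation
  strict.\<close>

lemma closedin_weak_topology_convex:
  fixes S :: "'a::real_normed_vector set"
  assumes "closed S" and "convex S"
  shows "closedin weak_topology S"
proof -
  have "\<exists>V. openin weak_topology V \<and> z \<in> V \<and> V \<subseteq> - S" if z: "z \<notin> S" for z
  proof (cases "S = {}")
    case True
    then show ?thesis
      using openin_topspace[of "weak_topology :: 'a topology"] by auto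
  next
    case False
    then obtain a where a: "a \<in> S"
      by auto
    obtain e where e: "e > 0" "ball z e \<subseteq> - S"
      using z \<open>closed S\<close> open_contains_ball[of "- S"] by (auto simp: closed_def)
    \<comment> \<open>The thickened set is translated by \<open>- a\<close>, which puts 0 into it;
      the point to separate becomes \<open>z - a\<close>.\<close>
    define C where "C = (\<Union>x\<in>(\<lambda>s. s - a) ` S. \<Union>u\<in>ball 0 e. {x + u})"
    have mem: "s - a + u \<in> C" if "s \<in> S" "norm u < e" for s u
      unfolding C_def using that by (intro UN_I[of "s - a"] UN_I[of u]) auto
    have "open C"
      unfolding C_def by (rule open_sums) simp
    moreover have "convex C"
      unfolding C_def using \<open>convex S\<close>
      by (intro convex_sums convex_translation_subtract convex_ball)
    moreover have "0 \<in> C"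
      using mem[of a 0] a e by simp
    moreover have "z - a \<notin> C"
    proof
      assume "z - a \<in> C"
      then obtain s u where "s \<in> S" "norm u < e" "z = s + u"
        by (auto simp: C_def algebra_simps)
      then have "s \<in> ball z e"
        by (simp add: dist_norm)
      with \<open>s \<in> S\<close> e show False
        by auto
    qed
    ultimately obtain f :: "'a \<Rightarrow> real" where f: "bounded_linear f"
      and le: "\<And>x. x \<in> C \<Longrightarrow> f x \<le> 1" and ge: "1 \<le> f (z - a)"
      using separate_point_open_convex[of C "z - a"] by blast
    interpret f: bounded_linear f by (rule f)
    have za: "z \<noteq> a"
      using z a by auto
    \<comment> \<open>A vector of norm \<open>e / 2\<close> in the direction of
      \<open>z - a\<close>: short enough for the thickening, and \<open>f\<close> is positive on
      it.\<close>
    define u where "u = (e / (2 * norm (z - a))) *\<^sub>R (z - a)"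
    have "norm u < e"
      using e za by (simp add: u_def)
    have "f u = (e / (2 * norm (z - a))) * f (z - a)"
      by (simp add: u_def f.scaleR)
    then have "f u > 0"
      using e za ge by simp
    \<comment> \<open>On \<open>S\<close> the functional stays at least \<open>f u\<close> below
      \<open>1 + f a\<close>, while \<open>f z\<close> is at least \<open>1 + f a\<close>. This gap
      makes the half-space \<open>V\<close> a weak neighbourhood of \<open>z\<close> that misses
      \<open>S\<close>.\<close>
    have le': "f s \<le> 1 + f a - f u" if "s \<in> S" for s
      using le[OF mem[OF that \<open>norm u < e\<close>]] by (simp add: f.add f.diff)
    define V where "V = blinfun_apply (Blinfun f) -` {1 + f a - f u<..}"
    have V: "V = {x. 1 + f a - f u < f x}"
      by (auto simp: V_def bounded_linear_Blinfun_apply[OF f])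
    have "openin weak_topology V"
      unfolding V_def by (rule openin_weak_topology_vimage) simp
    moreover have "z \<in> V"
      using ge \<open>f u > 0\<close> by (simp add: V f.diff)
    moreover have "V \<subseteq> - S"
      using le' by (force simp: V)
    ultimately show ?thesis
      by blast
  qed
  then have "openin weak_topology (- S)"
    by (subst openin_subopen) auto
  then show ?thesis
    by (simp add: closedin_def Compl_eq_Diff_UNIV)
qed

section \<open>Weak cluster points in reflexive spaces\<close>

text \<open>If \<open>x\<close> were outside \<open>S\<close>, the \<open>y k\<close> would
  eventually be outside too. For subbasic open sets this is the convergence of
  \<open>f (y k)\<close>; induction on the generation of \<open>- S\<close> carries it through
  finite intersections and arbitrary unions.\<close>

lemma weak_limit_in_closedin:
  fixes y :: "'b \<Rightarrow> 'a::real_normed_vector"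
  assumes "G \<noteq> bot" and lim: "\<And>f :: 'a \<Rightarrow>\<^sub>L real. ((\<lambda>k. f (y k)) \<longlongrightarrow> f x) G"
    and S: "closedin weak_topology S" and ev: "\<forall>\<^sub>F k in G. y k \<in> S"
  shows "x \<in> S"
proof (rule ccontr)
  assume "x \<notin> S"
  have "generate_topology_on {blinfun_apply f -` U | (f :: 'a \<Rightarrow>\<^sub>L real) U. open U} (- S)"
    using S by (simp add: closedin_def weak_topology_def[symmetric] Compl_eq_Diff_UNIV
        openin_topology_generated_by_iff[symmetric])
  then have "x \<in> - S \<longrightarrow> (\<forall>\<^sub>F k in G. y k \<in> - S)"
  proof induction
    case (Int a b)
    then show ?case
      by (auto intro: eventually_conj)
  next
    case (UN K)
    show ?case
    proof
      assume "x \<in> \<Union>K"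
      then obtain k where k: "k \<in> K" "x \<in> k"
        by blast
      with UN.IH have "\<forall>\<^sub>F j in G. y j \<in> k"
        by blast
      then show "\<forall>\<^sub>F j in G. y j \<in> \<Union>K"
        using k by (auto elim: eventually_mono)
    qed
  next
    case (Basis V)
    then obtain f :: "'a \<Rightarrow>\<^sub>L real" and U where "open U" "V = blinfun_apply f -` U"
      by auto
    then show ?case
      using topological_tendstoD[OF lim[of f]] by auto
  qed auto
  with \<open>x \<notin> S\<close> ev have "\<forall>\<^sub>F k in G. False"
    by (auto elim: eventually_elim2)
  with \<open>G \<noteq> bot\<close> show False
    by simp
qed

text \<open>A bounded sequence defines a sequence of functions on the dual with values in a compact
  product of intervals. Any cluster point of these functions is a bounded linear functional on the
  dual, hence by reflexivity the evaluation at a point.\<close>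

lemma reflexive_weak_cluster_point:
  fixes y :: "nat \<Rightarrow> 'a::real_normed_vector"
  assumes refl: "reflexive_banach_space TYPE('a)" and "bounded (range y)"
  obtains x where "\<And>S. closedin weak_topology S \<Longrightarrow> (\<forall>\<^sub>F k in sequentially. y k \<in> S) \<Longrightarrow> x \<in> S"
proof -
  obtain M where M: "\<And>k. norm (y k) \<le> M"
    using \<open>bounded (range y)\<close> by (auto simp: bounded_iff)
  define ev :: "nat \<Rightarrow> ('a \<Rightarrow>\<^sub>L real) \<Rightarrow> real" where "ev k f = f (y k)" for k f
  define K :: "(('a \<Rightarrow>\<^sub>L real) \<Rightarrow> real) set" where "K = (\<Pi>\<^sub>E f\<in>UNIV. {- (norm f * M)..norm f * M})"
  \<comment> \<open>Tychonoff's theorem enters through \<open>compactin_PiE\<close>.\<close>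
  have "compactin (product_topology (\<lambda>_. euclidean) UNIV) K"
    unfolding K_def compactin_PiE by auto
  then have "compact K"
    by (simp add: euclidean_product_topology)
  have "ev k \<in> K" for k
  proof -
    have "\<bar>ev k f\<bar> \<le> norm f * M" for f
      using norm_blinfun[of f "y k"] mult_left_mono[OF M[of k] norm_ge_zero[of f]]
      by (simp add: ev_def)
    then show ?thesis
      by (auto simp: K_def abs_le_iff minus_le_iff)
  qed
  then obtain \<Phi> where \<Phi>: "\<Phi> \<in> K" "inf (nhds \<Phi>) (filtermap ev sequentially) \<noteq> bot"
    using \<open>compact K\<close>[unfolded compact_filter, rule_format, of "filtermap ev sequentially"]
    by (auto simp: filtermap_bot_iff eventually_filtermap)
  \<comment> \<open>This filter refines \<open>sequentially\<close> and makes \<open>ev\<close>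
    converge to \<open>\<Phi>\<close>. It stands in for a convergent subsequence, which compactness
    alone does not provide.\<close>
  define G where "G = inf (filtercomap ev (nhds \<Phi>)) sequentially"
  \<comment> \<open>Otherwise some neighbourhood of \<open>\<Phi>\<close> would miss a tail of
    \<open>ev\<close>, so \<open>\<Phi>\<close> would not be a cluster point.\<close>
  have "G \<noteq> bot"
  proof
    assume "G = bot"
    then obtain P Q where P: "eventually P (nhds \<Phi>)" and Q: "eventually Q sequentially"
      and PQ: "\<And>k. P (ev k) \<Longrightarrow> Q k \<Longrightarrow> False"
      unfolding G_def trivial_limit_def eventually_inf eventually_filtercomap by metis
    then have "\<forall>\<^sub>F u in filtermap ev sequentially. \<not> P u"
      using PQ unfolding eventually_filtermap by (intro eventually_mono[OF Q]) blast
    then have "\<forall>\<^sub>F u in inf (nhds \<Phi>) (filtermap ev sequentially). False"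
      using P by (auto simp: eventually_inf)
    with \<Phi> show False
      by simp
  qed
  have ev_lim: "filterlim ev (nhds \<Phi>) G"
    unfolding filterlim_def G_def
    by (meson filtermap_filtercomap filtermap_mono inf_le1 order_trans)
  have lim: "((\<lambda>k. f (y k)) \<longlongrightarrow> \<Phi> f) G" for f :: "'a \<Rightarrow>\<^sub>L real"
  proof (rule topological_tendstoI)
    fix U :: "real set" assume U: "open U" "\<Phi> f \<in> U"
    have "open ((\<lambda>u. u f) -` U)"
      using open_vimage[OF U(1) continuous_on_product_coordinates] .
    then show "\<forall>\<^sub>F k in G. f (y k) \<in> U"
      using topological_tendstoD[OF ev_lim, of "(\<lambda>u. u f) -` U"] U by (simp add: ev_def)
  qed
  \<comment> \<open>Linearity passes to the coordinatewise limit, and the bound comes from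
    \<open>\<Phi> \<in> K\<close>.\<close>
  have "bounded_linear \<Phi>"
  proof
    show "\<Phi> (f + g) = \<Phi> f + \<Phi> g" for f g
      using tendsto_unique[OF \<open>G \<noteq> bot\<close> lim[of "f + g"]] tendsto_add[OF lim[of f] lim[of g]]
      by (simp add: plus_blinfun.rep_eq)
    show "\<Phi> (c *\<^sub>R f) = c *\<^sub>R \<Phi> f" for c f
      using tendsto_unique[OF \<open>G \<noteq> bot\<close> lim[of "c *\<^sub>R f"]] tendsto_mult_left[OF lim[of f], of c]
      by (simp add: scaleR_blinfun.rep_eq)
    have "norm (\<Phi> f) \<le> norm f * M" for f
      using \<Phi>(1) by (simp add: K_def PiE_iff abs_le_iff minus_le_iff)
    then show "\<exists>M. \<forall>f. norm (\<Phi> f) \<le> norm f * M"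
      by blast
  qed
  then obtain x where x: "\<And>f. \<Phi> f = blinfun_apply f x"
    using refl unfolding reflexive_banach_space_def
    by (metis bounded_linear_Blinfun_apply)
  show ?thesis
  proof (rule that)
    fix S assume S: "closedin weak_topology S" "\<forall>\<^sub>F k in sequentially. y k \<in> S"
    then have "\<forall>\<^sub>F k in G. y k \<in> S"
      unfolding G_def by (meson filter_leD inf_le2)
    with S show "x \<in> S"
      using weak_limit_in_closedin[OF \<open>G \<noteq> bot\<close>] lim x by metis
  qed
qed

section \<open>Cluster points in finite-dimensional spaces\<close>

text \<open>Induction on \<open>B\<close>. A new vector \<open>b\<close> outside
  \<open>span B\<close> has positive distance from it, so its coefficient in a bounded vector is
  bounded, and so is the remaining part in \<open>span B\<close>. Sums of the two range over a
  continuous image of a compact product. The inclusion \<open>K \<subseteq> span B\<close> yields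
  the closedness of \<open>span B\<close> behind the positive distance.\<close>

lemma bounded_subset_compact_in_span:
  fixes B :: "'a::real_normed_vector set"
  assumes "finite B"
  shows "\<exists>K. compact K \<and> cball 0 M \<inter> span B \<subseteq> K \<and> K \<subseteq> span B"
  using assms
proof (induction B arbitrary: M)
  case empty
  then show ?case
    by (intro exI[of _ "{0}"]) auto
next
  case (insert b B)
  show ?case
  proof (cases "b \<in> span B")
    case True
    then show ?thesis
      using insert.IH[of M] by (simp add: span_redundant)
  next
    case False
    \<comment> \<open>A convergent sequence is bounded, so it stays in a compact subset of
      \<open>span B\<close>, which contains its limit.\<close>
    have "closed (span B)"
      unfolding closed_sequential_limits
    proof (intro allI impI, elim conjE)
      fix v l assume v: "\<forall>k. v k \<in> span B" and lim: "v \<longlonglongrightarrow> l"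
      obtain M where M: "\<And>k. norm (v k) \<le> M"
        using convergent_imp_bounded[OF lim] by (auto simp: bounded_iff)
      obtain K where K: "compact K" "cball 0 M \<inter> span B \<subseteq> K" "K \<subseteq> span B"
        using insert.IH by blast
      then have "v k \<in> K" for k
        using M v by auto
      then have "l \<in> K"
        using closed_sequentially[OF compact_imp_closed[OF K(1)]] lim by blast
      with K show "l \<in> span B"
        by auto
    qed
    then obtain d where d: "d > 0" "ball b d \<subseteq> - span B"
      using False open_contains_ball[of "- span B"] by (auto simp: closed_def)
    have far: "\<bar>c\<bar> * d \<le> norm (c *\<^sub>R b + w)" if w: "w \<in> span B" for c w
    proof (cases "c = 0")
      case False
      have "- (w /\<^sub>R c) \<in> span B"
        using w by (simp add: span_neg span_scale)
      then have "d \<le> dist b (- (w /\<^sub>R c))"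
        using d by (force simp: not_less)
      then have "\<bar>c\<bar> * d \<le> \<bar>c\<bar> * norm (b + w /\<^sub>R c)"
        by (intro mult_left_mono) (auto simp: dist_norm)
      also have "\<dots> = norm (c *\<^sub>R b + w)"
        using False by (simp add: norm_scaleR[symmetric] scaleR_add_right del: norm_scaleR)
      finally show ?thesis .
    qed simp
    \<comment> \<open>By \<open>far\<close>, this bounds the coefficient of \<open>b\<close>; the
      remainder then has norm at most \<open>M + R * norm b\<close>.\<close>
    define R where "R = M / d"
    obtain K where K: "compact K" "cball 0 (M + R * norm b) \<inter> span B \<subseteq> K" "K \<subseteq> span B"
      using insert.IH by blast
    define L where "L = (\<lambda>(c, w). c *\<^sub>R b + w) ` ({- R..R} \<times> K)"
    have "compact L"
      unfolding L_def
      by (intro compact_continuous_image compact_Times K compact_Icc)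
        (auto simp: split_beta intro!: continuous_intros)
    moreover have "L \<subseteq> span (insert b B)"
      using K(3) span_mono[OF subset_insertI] unfolding L_def
      by (clarsimp, intro span_add span_scale) (auto intro: span_base)
    moreover have "cball 0 M \<inter> span (insert b B) \<subseteq> L"
    proof
      fix v assume v: "v \<in> cball 0 M \<inter> span (insert b B)"
      then obtain c where c: "v - c *\<^sub>R b \<in> span B"
        by (auto simp: span_breakdown_eq)
      have "\<bar>c\<bar> * d \<le> M"
        using far[OF c, of c] v by simp
      then have cR: "\<bar>c\<bar> \<le> R"
        using d by (simp add: R_def field_simps)
      have "norm (v - c *\<^sub>R b) \<le> norm v + \<bar>c\<bar> * norm b"
        using norm_triangle_ineq4[of v "c *\<^sub>R b"] by simp
      also have "\<dots> \<le> M + R * norm b"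
        using v cR by (intro add_mono mult_right_mono) auto
      finally have "v - c *\<^sub>R b \<in> K"
        using c K by auto
      with cR show "v \<in> L"
        by (auto simp: L_def abs_le_iff intro!: image_eqI[of _ _ "(c, v - c *\<^sub>R b)"])
    qed
    ultimately show ?thesis
      by blast
  qed
qed

text \<open>The limit of a convergent subsequence serves. The conclusion speaks of closed sets to
  match the weak cluster points, so that both cases can be treated together.\<close>

lemma finite_dimensional_cluster_point:
  fixes y :: "nat \<Rightarrow> 'a::real_normed_vector"
  assumes "finite_dimensional_space TYPE('a)" and "bounded (range y)"
  obtains x where "\<And>S. closed S \<Longrightarrow> (\<forall>\<^sub>F k in sequentially. y k \<in> S) \<Longrightarrow> x \<in> S"
proof -
  obtain B :: "'a set" where B: "finite B" "span B = UNIV"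
    using assms by (auto simp: finite_dimensional_space_def)
  obtain M where M: "\<And>k. norm (y k) \<le> M"
    using \<open>bounded (range y)\<close> by (auto simp: bounded_iff)
  obtain K :: "'a set" where K: "compact K" "cball 0 M \<subseteq> K"
    using bounded_subset_compact_in_span[OF B(1), of M] unfolding B(2) by auto
  then obtain x r where r: "strict_mono r" "(y \<circ> r) \<longlonglongrightarrow> x"
    using M compact_imp_seq_compact[OF K(1)] unfolding seq_compact_def
    by (metis mem_cball_0 subsetD)
  show ?thesis
  proof (rule that)
    fix S assume S: "closed S" "\<forall>\<^sub>F k in sequentially. y k \<in> S"
    then have "\<forall>\<^sub>F k in sequentially. (y \<circ> r) k \<in> S"
      using eventually_subseq[OF r(1)] by simp
    with S r show "x \<in> S"
      by (intro Lim_in_closed_set[of S "y \<circ> r"]) auto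
  qed
qed

section \<open>Attainment of the minimal time\<close>

text \<open>A ball around 0 inside \<open>F\<close>, scaled up, absorbs \<open>q - x\<close> for any
  \<open>q \<in> Q\<close>. Hence the infimum in \<open>minimal_time\<close> is over a nonempty
  set.\<close>

lemma ex_intersecting_time:
  fixes F Q :: "'a::real_normed_vector set"
  assumes "0 \<in> interior F" and "Q \<noteq> {}"
  shows "\<exists>t\<ge>0. (\<lambda>y. x + t *\<^sub>R y) ` F \<inter> Q \<noteq> {}"
proof -
  obtain q where q: "q \<in> Q"
    using assms by auto
  obtain d where d: "d > 0" "ball 0 d \<subseteq> F"
    using \<open>0 \<in> interior F\<close> by (auto simp: mem_interior)
  define w where "w = q - x"
  \<comment> \<open>The summand 1 makes \<open>s\<close> positive and the bound
    \<open>norm w < s * d\<close> strict.\<close>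
  define s where "s = norm w / d + 1"
  have "s > 0"
    using d by (auto simp: s_def intro!: add_nonneg_pos)
  moreover have "norm w < s * d"
    using d by (simp add: s_def distrib_right)
  ultimately have s: "s > 0" "norm w < s * d"
    by auto
  then have "w /\<^sub>R s \<in> F"
    using d by (intro subsetD[OF d(2)]) (simp add: field_simps)
  moreover have "x + s *\<^sub>R (w /\<^sub>R s) = q"
    using s by (simp add: w_def)
  ultimately show ?thesis
    using q s by (metis disjoint_iff imageI less_imp_le)
qed

lemma minimal_time_nonneg:
  fixes F Q :: "'a::real_normed_vector set"
  assumes "0 \<in> interior F" and "Q \<noteq> {}"
  shows "0 \<le> minimal_time F x Q"
  unfolding minimal_time_def
  using ex_intersecting_time[OF assms] by (intro cInf_greatest) auto

text \<open>The topology \<open>X\<close> is a parameter so that one argument covers the norm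
  topology in finite dimension and the weak topology in the reflexive case. The assumption
  \<open>closedin\<close> is trivial in the first case and Mazur's theorem in the second.\<close>

lemma minimal_time_le_iff:
  fixes F Q :: "'a::real_normed_vector set" and X :: "'a topology"
  assumes "closed F" "bounded F" "convex F" "0 \<in> interior F"
    and Q: "Q \<noteq> {}" "closedin X Q"
    and closedin: "\<And>C. closed C \<Longrightarrow> convex C \<Longrightarrow> closedin X C"
    and cluster: "\<And>y :: nat \<Rightarrow> 'a. bounded (range y) \<Longrightarrow>
      \<exists>z. \<forall>S. closedin X S \<longrightarrow> (\<forall>\<^sub>F k in sequentially. y k \<in> S) \<longrightarrow> z \<in> S"
    and "0 \<le> t"
  shows "minimal_time F x Q \<le> t \<longleftrightarrow> (\<lambda>y. x + t *\<^sub>R y) ` F \<inter> Q \<noteq> {}"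
proof -
  define E where "E t = (\<lambda>y. x + t *\<^sub>R y) ` F" for t
  define D where "D = {t. 0 \<le> t \<and> E t \<inter> Q \<noteq> {}}"
  have time: "minimal_time F x Q = Inf D"
    by (simp add: minimal_time_def D_def E_def)
  have bdd: "bdd_below D"
    by (rule bdd_belowI[of _ 0]) (auto simp: D_def)
  have "0 \<in> F"
    using \<open>0 \<in> interior F\<close> interior_subset by blast
  \<comment> \<open>Convexity and \<open>0 \<in> F\<close> make the sets \<open>E t\<close> increase
    with \<open>t\<close>.\<close>
  have mono: "E s \<subseteq> E t" if "0 \<le> s" "s \<le> t" for s t
  proof
    fix v assume "v \<in> E s"
    then obtain f where f: "f \<in> F" "v = x + s *\<^sub>R f"
      by (auto simp: E_def)
    show "v \<in> E t"
    proof (cases "t = 0")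
      case True
      with that f show ?thesis
        by (auto simp: E_def)
    next
      case False
      then have "(s / t) *\<^sub>R f + (1 - s / t) *\<^sub>R 0 \<in> F"
        using that f \<open>0 \<in> F\<close> by (intro convexD[OF \<open>convex F\<close>]) auto
      with f False show ?thesis
        by (auto simp: E_def intro!: image_eqI[of _ _ "(s / t) *\<^sub>R f"])
    qed
  qed
  have "D \<noteq> {}"
    using ex_intersecting_time[OF \<open>0 \<in> interior F\<close> Q(1), of x] by (auto simp: D_def E_def)
  obtain M where M: "\<And>f. f \<in> F \<Longrightarrow> norm f \<le> M"
    using \<open>bounded F\<close> by (auto simp: bounded_iff)
  have "t \<in> D" if le: "Inf D \<le> t"
  proof -
    \<comment> \<open>Times strictly above \<open>t\<close> exceed some element of \<open>D\<close>,
      so by \<open>mono\<close> the sets at these times meet \<open>Q\<close>.\<close>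
    define s where "s k = t + inverse (real (Suc k))" for k
    have s: "s k > t" "s k \<ge> 0" "s k \<le> t + 1" for k
      using \<open>0 \<le> t\<close> by (auto simp: s_def field_simps)
    have s_lim: "s \<longlonglongrightarrow> t"
      unfolding s_def by (rule LIMSEQ_inverse_real_of_nat_add)
    have "E (s k) \<inter> Q \<noteq> {}" for k
    proof -
      obtain u where "u \<in> D" "u < s k"
        using cInf_lessD[OF \<open>D \<noteq> {}\<close>, of "s k"] le s(1)[of k] by auto
      then show ?thesis
        using mono[of u "s k"] by (auto simp: D_def)
    qed
    then have "\<exists>v. v \<in> E (s k) \<and> v \<in> Q" for k
      by blast
    then obtain y where y: "\<And>k. y k \<in> E (s k)" "\<And>k. y k \<in> Q"
      by metis
    have "norm (y k) \<le> norm x + (t + 1) * M" for k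
    proof -
      obtain f where f: "f \<in> F" "y k = x + s k *\<^sub>R f"
        using y(1)[of k] by (auto simp: E_def)
      have "norm (y k) \<le> norm x + s k * norm f"
        using norm_triangle_ineq[of x "s k *\<^sub>R f"] f s[of k] by simp
      also have "\<dots> \<le> norm x + (t + 1) * M"
        using M[OF f(1)] s[of k] \<open>0 \<le> t\<close> by (intro add_left_mono mult_mono) auto
      finally show ?thesis .
    qed
    then have "bounded (range y)"
      by (auto simp: bounded_iff)
    then obtain z where z: "\<And>S. closedin X S \<Longrightarrow> (\<forall>\<^sub>F k in sequentially. y k \<in> S) \<Longrightarrow> z \<in> S"
      using cluster by meson
    have "z \<in> Q"
      using z[OF Q(2)] y by simp
    \<comment> \<open>For fixed \<open>k\<close>, all but finitely many \<open>y j\<close> lie in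
      the closed convex set \<open>E (s k)\<close>.\<close>
    have "z \<in> E (s k)" for k
    proof (rule z)
      have "E (s k) = (+) x ` (*\<^sub>R) (s k) ` F"
        by (auto simp: E_def)
      then show "closedin X (E (s k))"
        using \<open>closed F\<close> \<open>convex F\<close>
        by (auto intro!: closedin closed_translation closed_scaling convex_translation convex_scaling)
      have "\<forall>\<^sub>F j in sequentially. s j < s k"
        using order_tendstoD(2)[OF s_lim s(1)] .
      then show "\<forall>\<^sub>F j in sequentially. y j \<in> E (s k)"
        using y(1) s(2) mono by (auto elim!: eventually_mono) (meson less_imp_le subsetD)
    qed
    then have "\<exists>f. f \<in> F \<and> z = x + s k *\<^sub>R f" for k
      by (auto simp: E_def)
    then obtain g where g: "\<And>k. g k \<in> F" "\<And>k. z = x + s k *\<^sub>R g k"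
      by metis
    \<comment> \<open>For \<open>t = 0\<close> boundedness of \<open>F\<close> forces
      \<open>z = x\<close>. Otherwise the points \<open>(z - x) /\<^sub>R s k\<close> of
      \<open>F\<close> converge in norm, and \<open>F\<close> is closed.\<close>
    have "z \<in> E t"
    proof (cases "t = 0")
      case True
      have "norm (z - x) \<le> s k * M" for k
        using g(2)[of k] M[OF g(1)[of k]] s(2)[of k] by (simp add: mult_left_mono)
      then have "norm (z - x) \<le> t * M"
        by (intro tendsto_lowerbound[OF tendsto_mult_right[OF s_lim]]) auto
      with True \<open>0 \<in> F\<close> show ?thesis
        by (auto simp: E_def)
    next
      case False
      have "(\<lambda>k. (z - x) /\<^sub>R s k) \<longlonglongrightarrow> (z - x) /\<^sub>R t"
        using s_lim False by (intro tendsto_intros)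
      moreover have "(z - x) /\<^sub>R s k = g k" for k
        using g(2)[of k] s(1)[of k] \<open>0 \<le> t\<close> by simp
      ultimately have "g \<longlonglongrightarrow> (z - x) /\<^sub>R t"
        by simp
      then have "(z - x) /\<^sub>R t \<in> F"
        by (rule closed_sequentially[OF \<open>closed F\<close> g(1)])
      then show ?thesis
        using False by (auto simp: E_def intro!: image_eqI[of _ _ "(z - x) /\<^sub>R t"])
    qed
    with \<open>z \<in> Q\<close> \<open>0 \<le> t\<close> show ?thesis
      by (auto simp: D_def)
  qed
  then show ?thesis
    using cInf_lower[OF _ bdd, of t] \<open>0 \<le> t\<close> by (auto simp: time D_def E_def)
qed

section \<open>Equivalence of the two problems\<close>

theorem proposition3p3:
  fixes F \<Omega> :: "'a::real_normed_vector set"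
    and \<Omega>s :: "nat \<Rightarrow> 'a set"
    and n :: nat and xbar :: 'a and r :: real
  assumes "closed F" and "bounded F" and "convex F" and "0 \<in> interior F"
    and "1 \<le> n"
    and "closed \<Omega>" and "\<Omega> \<noteq> {}"
    and "\<And>i. i \<in> {1..n} \<Longrightarrow> closed (\<Omega>s i) \<and> \<Omega>s i \<noteq> {}"
    and "finite_dimensional_space TYPE('a) \<or>
         (reflexive_banach_space TYPE('a) \<and> closedin weak_topology \<Omega> \<and>
          (\<forall>i\<in>{1..n}. closedin weak_topology (\<Omega>s i)))"
    and "xbar \<in> \<Omega>" and "0 \<le> r"
  shows "(constrained_minimizer (max_time F n \<Omega>s) \<Omega> xbar \<and> r = max_time F n \<Omega>s xbar) \<longleftrightarrow>
         smallest_intersecting_ball F n \<Omega>s \<Omega> xbar r"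
proof -
  have iff: "minimal_time F x (\<Omega>s i) \<le> t \<longleftrightarrow> (\<lambda>y. x + t *\<^sub>R y) ` F \<inter> \<Omega>s i \<noteq> {}"
    if i: "i \<in> {1..n}" and t: "0 \<le> t" for x i t
    using assms(9)
  proof
    assume "finite_dimensional_space TYPE('a)"
    from finite_dimensional_cluster_point[OF this] show ?thesis
      using assms(8)[OF i] t
      by (intro minimal_time_le_iff[where X = euclidean] assms(1-4))
        (simp, simp, simp, metis closed_closedin, simp)
  next
    assume *: "reflexive_banach_space TYPE('a) \<and> closedin weak_topology \<Omega> \<and>
      (\<forall>i\<in>{1..n}. closedin weak_topology (\<Omega>s i))"
    then have "reflexive_banach_space TYPE('a)" ..
    from reflexive_weak_cluster_point[OF this] show ?thesis
      using assms(8)[OF i] t * i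
      by (intro minimal_time_le_iff[where X = weak_topology] assms(1-4))
        (simp, simp, blast intro: closedin_weak_topology_convex, metis, simp)
  qed
  have nonneg: "0 \<le> max_time F n \<Omega>s x" for x
    using \<open>1 \<le> n\<close> assms(8) minimal_time_nonneg[OF \<open>0 \<in> interior F\<close>, of "\<Omega>s 1" x]
    unfolding max_time_def by (intro Max_ge_iff[THEN iffD2]) auto
  have max_iff: "max_time F n \<Omega>s x \<le> t \<longleftrightarrow> (\<forall>i\<in>{1..n}. (\<lambda>y. x + t *\<^sub>R y) ` F \<inter> \<Omega>s i \<noteq> {})"
    if "0 \<le> t" for x t
    using \<open>1 \<le> n\<close> iff[OF _ that] unfolding max_time_def by (subst Max_le_iff) auto
  have "smallest_intersecting_ball F n \<Omega>s \<Omega> xbar r \<longleftrightarrow>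
    max_time F n \<Omega>s xbar \<le> r \<and> (\<forall>x\<in>\<Omega>. \<forall>t\<ge>0. max_time F n \<Omega>s x \<le> t \<longrightarrow> r \<le> t)"
    using \<open>xbar \<in> \<Omega>\<close> \<open>0 \<le> r\<close> by (auto simp: smallest_intersecting_ball_def max_iff)
  \<comment> \<open>Since \<open>max_time\<close> is nonnegative, its value at \<open>x\<close> is
    itself an admissible \<open>t\<close>, and it is the least one.\<close>
  also have "\<dots> \<longleftrightarrow> max_time F n \<Omega>s xbar \<le> r \<and> (\<forall>x\<in>\<Omega>. r \<le> max_time F n \<Omega>s x)"
    using nonneg by (meson order_trans order_refl)
  \<comment> \<open>The lower bound at \<open>x = xbar\<close> turns
    \<open>max_time F n \<Omega>s xbar \<le> r\<close> into an equality.\<close>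
  also have "\<dots> \<longleftrightarrow> constrained_minimizer (max_time F n \<Omega>s) \<Omega> xbar \<and> r = max_time F n \<Omega>s xbar"
    using \<open>xbar \<in> \<Omega>\<close> by (force simp: constrained_minimizer_def)
  finally show ?thesis ..
qed

end
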